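(* Let $\{P_n(x)\}_{n\ge 1}$, $c_n(k)$ and $R_k(n)$ be as defined in the context. For all integers $k\ge1$, $n\ge1$, $$R_k(n)=2^n(k-1)!\,4^{k-1}-\sum_{i=1}^{n}2^{n-i}\frac{(2k+i-2)!}{(k+i-1)!}.$$
   Context: The sequence $\{P_n(x)\}_{n\ge1}$ of rational functions of $x$ is defined by $P_1=P_2=1$ and, for $n\ge 2$: if $n$ is odd, $4(2x+n)P_{n+1}(x)=2(x+n)P_n(x)+(2x+n)P_n(x+1)+(4x+n)\ell_n(x)$; if $n$ is even, $4P_{n+1}(x)=4(x+n)P_n(x)+2(2x+n+1)P_n(x+1)+(4x+n)\ell_{n-1}(x)$. Here for odd $r\ge1$, $\ell_r(x)=\prod_{j=1}^{(r-1)/2}(x+j)$ (the empty product equals $1$). For integers $n,k\ge1$, $c_n(k)=(\frac{n-1}{2})!\prod_{i=1}^{k-1}\frac{n+i}{n+2i}$ if $n$ is odd and $c_n(k)=\frac12(\frac n2-1)!\prod_{i=0}^{k-1}\frac{n+i}{n+2i+1}$ if $n$ is even, and $R_k(n)$ is defined by $R_k(n)=(2k-2)!!\left(2^{n+k-1}-P_n(k)/c_n(k)\right)$, where $(2k-2)!!=2^{k-1}(k-1)!$. *)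

theory Defs
  imports
    Complex_Main
    "HOL-Computational_Algebra.Computational_Algebra"
    "HOL-Computational_Algebra.Field_as_Ring"
begin

text \<open>
  Rational functions in one variable over the rationals are elements of the fraction field
  \<^typ>\<open>rat poly fract\<close>.
\<close>

type_synonym ratfun = "rat poly fract"

definition X :: ratfun where
  "X = Fract [:0, 1:] 1"

text \<open>The substitution of \<open>x + 1\<close> for \<open>x\<close>.\<close>

definition shift :: "ratfun \<Rightarrow> ratfun" where
  "shift f = Fract (pcompose (fst (quot_of_fract f)) [:1, 1:])
                   (pcompose (snd (quot_of_fract f)) [:1, 1:])"

text \<open>
  The value of a rational function at a point, computed from its representation in lowest terms.
  At a pole this is the value \<open>0\<close> of a division by zero.
\<close>

definition eval :: "ratfun \<Rightarrow> rat \<Rightarrow> rat" where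
  "eval f a = poly (fst (quot_of_fract f)) a / poly (snd (quot_of_fract f)) a"

lemma shift_Fract:
  assumes "q \<noteq> 0"
  shows "shift (Fract p q) = Fract (pcompose p [:1, 1:]) (pcompose q [:1, 1:])"
proof -
  define p' q' where "p' = fst (quot_of_fract (Fract p q))" and "q' = snd (quot_of_fract (Fract p q))"
  have "Fract p' q' = Fract p q" and nz: "q' \<noteq> 0"
    by (simp_all add: p'_def q'_def)
  then have "p' * q = p * q'"
    using assms by (simp add: eq_fract)
  then have eq: "pcompose p' [:1, 1:] * pcompose q [:1, 1:] =
      pcompose p [:1, 1:] * pcompose q' [:1, 1:]"
    by (metis pcompose_mult)
  have "pcompose q [:1, 1:] \<noteq> 0" "pcompose q' [:1, 1:] \<noteq> 0"
    using assms nz by (simp_all add: pcompose_eq_0_iff)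
  with eq show ?thesis
    by (simp add: shift_def p'_def q'_def eq_fract)
qed

lemma eval_Fract:
  assumes "poly q a \<noteq> 0"
  shows "eval (Fract p q) a = poly p a / poly q a"
proof -
  define p' q' where "p' = fst (quot_of_fract (Fract p q))" and "q' = snd (quot_of_fract (Fract p q))"
  have "Fract p' q' = Fract p q" "q' \<noteq> 0" "q \<noteq> 0"
    using assms by (auto simp: p'_def q'_def)
  then have eq: "p' * q = p * q'"
    by (simp add: eq_fract)
  have "coprime p' q'"
    unfolding p'_def q'_def by (rule coprime_quot_of_fract)
  moreover have "q' dvd p' * q"
    by (simp add: eq)
  ultimately have "q' dvd q"
    using coprime_dvd_mult_right_iff coprime_commute by blast
  then have "poly q' a \<noteq> 0"
    using assms by auto
  moreover have "poly p' a * poly q a = poly p a * poly q' a"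
    by (metis eq poly_mult)
  ultimately show ?thesis
    using assms by (simp add: eval_def p'_def q'_def frac_eq_eq)
qed

definition ell :: "nat \<Rightarrow> ratfun" where
  "ell r = (\<Prod>j = 1..(r - 1) div 2. X + of_nat j)"

text \<open>The value at index \<open>0\<close> is irrelevant.\<close>

primrec P :: "nat \<Rightarrow> ratfun" where
  "P 0 = 1"
| "P (Suc n) =
    (if n < 2 then 1
     else if odd n then
       (2 * (X + of_nat n) * P n + (2 * X + of_nat n) * shift (P n) + (4 * X + of_nat n) * ell n)
         / (4 * (2 * X + of_nat n))
     else
       (4 * (X + of_nat n) * P n + 2 * (2 * X + of_nat n + 1) * shift (P n)
         + (4 * X + of_nat n) * ell (n - 1)) / 4)"

lemma P_1: "P 1 = 1" and P_2: "P 2 = 1"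
  by (simp_all add: numeral_2_eq_2)

lemma two_X_plus_nonzero: "2 * X + of_nat n \<noteq> 0"
proof -
  have "2 * X + of_nat n = X + X + of_nat n"
    by simp
  also have "\<dots> = Fract ([:0, 1:] + [:0, 1:] + of_nat n) 1"
    by (simp add: X_def of_nat_fract)
  also have "\<dots> \<noteq> 0"
    by (simp add: Zero_fract_def eq_fract of_nat_poly)
  finally show ?thesis .
qed

lemma P_rec_odd:
  assumes "n \<ge> 2" "odd n"
  shows "4 * (2 * X + of_nat n) * P (n + 1) =
    2 * (X + of_nat n) * P n + (2 * X + of_nat n) * shift (P n) + (4 * X + of_nat n) * ell n"
proof -
  have nz: "4 * (2 * X + of_nat n) \<noteq> 0"
    using two_X_plus_nonzero[of n] by (simp add: mult_eq_0_iff)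
  show ?thesis
    using assms nz by simp
qed

lemma P_rec_even:
  assumes "n \<ge> 2" "even n"
  shows "4 * P (n + 1) =
    4 * (X + of_nat n) * P n + 2 * (2 * X + of_nat n + 1) * shift (P n)
      + (4 * X + of_nat n) * ell (n - 1)"
  using assms by simp

definition c :: "nat \<Rightarrow> nat \<Rightarrow> rat" where
  "c n k =
    (if odd n then
       fact ((n - 1) div 2) * (\<Prod>i = 1..k - 1. of_nat (n + i) / of_nat (n + 2 * i))
     else
       1 / 2 * fact (n div 2 - 1) * (\<Prod>i = 0..k - 1. of_nat (n + i) / of_nat (n + 2 * i + 1)))"

definition R :: "nat \<Rightarrow> nat \<Rightarrow> rat" where
  "R k n = 2 ^ (k - 1) * fact (k - 1) * (2 ^ (n + k - 1) - eval (P n) (of_nat k) / c n k)"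

end

theory Submission
  imports Defs
begin

text \<open>
  The denominators that occur do not vanish at positive integers, so the recurrence may be evaluated
  at \<open>k = j + 1\<close>. There the claim says that \<open>P n\<close> has the value
  \<open>c n k / 2 ^ (k - 1) * S n j\<close> with \<open>S n j = (\<Sum>i = 1..n. 2 ^ (n - i) * (2 j + i choose j))\<close>.
  Pascal's rule expresses both \<open>S (n + 1) j\<close> and \<open>S n (j + 1)\<close> through \<open>S n j\<close> and one binomial
  coefficient. The recurrence for \<open>P\<close> then becomes linear in \<open>S n j\<close>: the coefficients of \<open>S n j\<close>
  agree by the quotients \<open>c (n + 1) k / c n k\<close> and \<open>c n (k + 1) / c n k\<close>, and the remaining
  terms agree because \<open>ell r\<close> at \<open>k\<close> is \<open>c r k / 2 ^ k * (2 k + r - 1 choose k)\<close> for odd \<open>r\<close>.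
\<close>

section \<open>Values of rational functions at regular points\<close>

definition has_value :: "ratfun \<Rightarrow> rat \<Rightarrow> rat \<Rightarrow> bool" where
  "has_value f a v \<longleftrightarrow> (\<exists>p q. f = Fract p q \<and> poly q a \<noteq> 0 \<and> v = poly p a / poly q a)"

lemma has_valueI: "f = Fract p q \<Longrightarrow> poly q a \<noteq> 0 \<Longrightarrow> v = poly p a / poly q a \<Longrightarrow> has_value f a v"
  unfolding has_value_def by blast

lemma has_valueE:
  assumes "has_value f a v"
  obtains p q where "f = Fract p q" "q \<noteq> 0" "poly q a \<noteq> 0" "v = poly p a / poly q a"
  using assms unfolding has_value_def by (metis poly_0)

lemma eval_eqI: "has_value f a v \<Longrightarrow> eval f a = v"
  by (auto simp: has_value_def eval_Fract)

lemma has_value_of_nat: "has_value (of_nat n) a (of_nat n)"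
  by (rule has_valueI[where p = "of_nat n" and q = 1]) (auto simp: of_nat_fract)

lemma has_value_1: "has_value 1 a 1"
  using has_value_of_nat[of 1] by simp

lemma has_value_numeral: "has_value (numeral m) a (numeral m)"
  using has_value_of_nat[of "numeral m"] by simp

lemma has_value_X: "has_value X a a"
  by (rule has_valueI[where p = "[:0, 1:]" and q = 1]) (auto simp: X_def)

lemma has_value_add:
  assumes "has_value f a v" "has_value g a w"
  shows "has_value (f + g) a (v + w)"
proof -
  from assms(1) obtain p q where f: "f = Fract p q" "q \<noteq> 0" "poly q a \<noteq> 0" "v = poly p a / poly q a"
    by (rule has_valueE)
  from assms(2) obtain r s where g: "g = Fract r s" "s \<noteq> 0" "poly s a \<noteq> 0" "w = poly r a / poly s a"
    by (rule has_valueE)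
  show ?thesis
    using f g by (intro has_valueI[where p = "p * s + r * q" and q = "q * s"]) (auto simp: add_frac_eq)
qed

lemma has_value_mult:
  assumes "has_value f a v" "has_value g a w"
  shows "has_value (f * g) a (v * w)"
proof -
  from assms(1) obtain p q where f: "f = Fract p q" "q \<noteq> 0" "poly q a \<noteq> 0" "v = poly p a / poly q a"
    by (rule has_valueE)
  from assms(2) obtain r s where g: "g = Fract r s" "s \<noteq> 0" "poly s a \<noteq> 0" "w = poly r a / poly s a"
    by (rule has_valueE)
  show ?thesis
    using f g by (intro has_valueI[where p = "p * r" and q = "q * s"]) auto
qed

lemma has_value_divide:
  assumes "has_value f a v" "has_value g a w" "w \<noteq> 0"
  shows "has_value (f / g) a (v / w)"
proof -
  from assms(1) obtain p q where f: "f = Fract p q" "q \<noteq> 0" "poly q a \<noteq> 0" "v = poly p a / poly q a"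
    by (rule has_valueE)
  from assms(2) obtain r s where g: "g = Fract r s" "s \<noteq> 0" "poly s a \<noteq> 0" "w = poly r a / poly s a"
    by (rule has_valueE)
  show ?thesis
    using f g assms(3) by (intro has_valueI[where p = "p * s" and q = "q * r"]) auto
qed

lemma has_value_prod:
  assumes "\<And>i. i \<in> I \<Longrightarrow> has_value (f i) a (v i)"
  shows "has_value (prod f I) a (prod v I)"
  using assms by (induction I rule: infinite_finite_induct) (auto intro: has_value_1 has_value_mult)

lemma has_value_shift:
  assumes "has_value f (a + 1) v"
  shows "has_value (shift f) a v"
proof -
  from assms obtain p q where f: "f = Fract p q" "q \<noteq> 0" "poly q (a + 1) \<noteq> 0"
    "v = poly p (a + 1) / poly q (a + 1)"
    by (rule has_valueE)
  show ?thesis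
    using f by (intro has_valueI[OF shift_Fract[of q p, folded f(1)]])
      (auto simp: poly_pcompose add.commute)
qed

lemmas has_value_intros = has_value_of_nat has_value_1 has_value_numeral has_value_X
  has_value_add has_value_mult has_value_divide has_value_prod

section \<open>Weighted sums of binomial coefficients\<close>

text \<open>This is the sum of the theorem at \<open>k = j + 1\<close>, divided by
  \<open>fact j\<close>.\<close>

definition S :: "nat \<Rightarrow> nat \<Rightarrow> rat" where
  "S n j = (\<Sum>i = 1..n. 2 ^ (n - i) * of_nat ((2 * j + i) choose j))"

lemma S_Suc: "S (Suc n) j = 2 * S n j + of_nat ((2 * j + n + 1) choose j)"
proof -
  have "(\<Sum>i = 1..n. 2 ^ (Suc n - i) * of_nat ((2 * j + i) choose j)) = 2 * S n j"
    unfolding S_def sum_distrib_left by (intro sum.cong) (auto simp: Suc_diff_le)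
  then show ?thesis
    by (simp add: S_def)
qed

lemma S_Suc_right:
  "S n (Suc j) = 4 * S n j + of_nat ((2 * j + n + 1) choose j) - of_nat ((2 * j + n + 1) choose Suc j)"
proof (induction n)
  case 0
  \<comment> \<open>Both sums are empty for \<open>n = 0\<close>, so the two middle coefficients of
    an odd row have to cancel.\<close>
  have "(2 * j + 1) choose j = (2 * j + 1) choose Suc j"
    by (subst binomial_symmetric) auto
  then show ?case
    by (simp add: S_def)
next
  case (Suc n)
  show ?case
    \<comment> \<open>After the last summands are split off, only Pascal's rule remains; the case
      distinction makes it applicable to lower index \<open>j\<close>.\<close>
    by (subst (1 2) S_Suc, subst Suc.IH, cases j) (simp_all add: algebra_simps)
qed

lemma Suc_times_binomial_Suc: "Suc k * (n choose Suc k) = (n - k) * (n choose k)"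
  using binomial_absorb_comp[of n k] Suc_times_binomial_eq[of "n - 1" k]
  by (cases n) (auto simp: mult.commute)

section \<open>The normalising factors\<close>

lemma c_nonzero: "n \<ge> 1 \<Longrightarrow> c n k \<noteq> 0"
  by (auto simp: c_def add_eq_0_iff)

lemma c_odd_Suc:
  "odd n \<Longrightarrow> c n (Suc (Suc j)) = c n (Suc j) * of_nat (n + Suc j) / of_nat (n + 2 * Suc j)"
  by (simp add: c_def algebra_simps)

lemma c_even_Suc:
  "even n \<Longrightarrow> c n (Suc (Suc j)) = c n (Suc j) * of_nat (n + Suc j) / of_nat (n + 2 * Suc j + 1)"
  by (simp add: c_def ac_simps)

text \<open>By induction on \<open>j\<close>: the preceding two lemmas supply the factor gained on
  each side, and the quotient of these factors is the change in the claimed quotient.\<close>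

lemma c_Suc_odd:
  assumes "odd n"
  shows "c (Suc n) (Suc j) = c n (Suc j) * of_nat (n + Suc j) / (2 * of_nat (n + 2 * Suc j))"
proof (induction j)
  case 0
  then show ?case using assms by (auto simp: c_def elim!: oddE)
next
  case (Suc j)
  then show ?case
    using assms c_odd_Suc[of n j] c_even_Suc[of "Suc n" j]
    by (simp del: of_nat_Suc of_nat_add add: ac_simps)
qed

lemma c_Suc_even:
  assumes "even n" "n \<ge> 2"
  shows "c (Suc n) (Suc j) = c n (Suc j) * of_nat (n + Suc j)"
proof (induction j)
  case 0
  \<comment> \<open>The two factorials become \<open>fact (Suc m)\<close> and \<open>fact m\<close>;
    their quotient cancels against the numerator \<open>n\<close> of the factor
    \<open>i = 0\<close>.\<close>
  from assms obtain m where "n = 2 * Suc m"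
    by (metis evenE One_nat_def Suc_1 mult_0_right not0_implies_Suc not_numeral_le_zero)
  then show ?case by (simp add: c_def field_simps)
next
  case (Suc j)
  then show ?case
    using assms c_even_Suc[of n j] c_odd_Suc[of "Suc n" j]
    by (simp del: of_nat_Suc of_nat_add add: ac_simps)
qed

section \<open>Evaluation of the recurrence\<close>

definition ell_value :: "nat \<Rightarrow> nat \<Rightarrow> rat" where
  "ell_value r j = (\<Prod>i = 1..(r - 1) div 2. of_nat (Suc j) + of_nat i)"

lemma has_value_ell: "has_value (ell r) (of_nat (Suc j)) (ell_value r j)"
  unfolding ell_def ell_value_def by (intro has_value_intros)

text \<open>\<open>ell\<close> is here a product of the \<open>m\<close> consecutive integers
  following \<open>Suc j\<close>, so \<open>fact (Suc j)\<close> completes it to a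
  factorial.\<close>

lemma fact_mult_ell_value: "fact (Suc j) * ell_value (2 * m + 1) j = fact (Suc j + m)"
proof (induction m)
  case (Suc m)
  have "fact (Suc j) * ell_value (2 * Suc m + 1) j =
      fact (Suc j) * ell_value (2 * m + 1) j * of_nat (Suc j + Suc m)"
    by (simp add: ell_value_def)
  also have "\<dots> = fact (Suc j + Suc m)"
    unfolding Suc.IH by simp
  finally show ?case .
qed (simp add: ell_value_def)

text \<open>Moving the point by one shifts the window of factors: \<open>j + 2\<close> leaves and
  \<open>j + 2 + m\<close> enters.\<close>

lemma ell_value_Suc:
  "of_nat (j + 2) * ell_value (2 * m + 1) (Suc j) = of_nat (j + 2 + m) * ell_value (2 * m + 1) j"
proof -
  have "fact (Suc j) * (of_nat (j + 2) * ell_value (2 * m + 1) (Suc j)) =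
      fact (Suc (Suc j)) * ell_value (2 * m + 1) (Suc j)"
    by (simp add: algebra_simps)
  also have "\<dots> = of_nat (j + 2 + m) * fact (Suc j + m)"
    unfolding fact_mult_ell_value by simp
  also have "\<dots> = fact (Suc j) * (of_nat (j + 2 + m) * ell_value (2 * m + 1) j)"
    unfolding fact_mult_ell_value[symmetric] by (simp only: ac_simps)
  finally show ?thesis
    by (simp del: fact_Suc)
qed

text \<open>By induction on \<open>j\<close>: each step multiplies both sides by
  \<open>(2 * j + r + 3) / (j + 2)\<close>.\<close>

lemma ell_value_odd:
  assumes "odd r"
  shows "2 ^ Suc j * ell_value r j = c r (Suc j) * of_nat ((2 * j + r + 1) choose Suc j)"
proof (induction j)
  case 0
  from assms obtain m where r: "r = 2 * m + 1"
    by (rule oddE)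
  show ?case
    using fact_mult_ell_value[of 0 m] by (simp add: r c_def algebra_simps)
next
  case (Suc j)
  from assms obtain m where r: "r = 2 * m + 1"
    by (rule oddE)
  \<comment> \<open>\<open>B'\<close> splits the passage from \<open>B\<close> to
    \<open>B''\<close>: first the row grows by one, then row and column together.\<close>
  define B :: rat where "B = of_nat ((2 * j + r + 1) choose Suc j)"
  define B' :: rat where "B' = of_nat ((2 * j + r + 2) choose Suc j)"
  define B'' :: rat where "B'' = of_nat ((2 * j + r + 3) choose Suc (Suc j))"
  have "(j + 2) * ((2 * j + r + 3) choose Suc (Suc j)) = (2 * j + r + 3) * ((2 * j + r + 2) choose Suc j)"
    using Suc_times_binomial_eq[of "2 * j + r + 2" "Suc j"] by (simp add: numeral_3_eq_3 ac_simps)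
  then have B'': "of_nat (j + 2) * B'' = of_nat (2 * j + r + 3) * B'"
    unfolding B'_def B''_def by (metis of_nat_mult)
  have "(j + 1 + r) * ((2 * j + r + 2) choose Suc j) = (2 * j + r + 2) * ((2 * j + r + 1) choose Suc j)"
    using binomial_absorb_comp[of "2 * j + r + 2" "Suc j"] by (simp add: ac_simps)
  then have B': "of_nat (j + 1 + r) * B' = of_nat (2 * j + r + 2) * B"
    unfolding B_def B'_def by (metis of_nat_mult)
  have "of_nat (j + 2) * (c r (Suc (Suc j)) * B'') = c r (Suc (Suc j)) * (of_nat (2 * j + r + 3) * B')"
    unfolding B''[symmetric] by (simp only: ac_simps)
  also have "\<dots> = c r (Suc j) * of_nat (2 * j + r + 3) * (of_nat (j + 1 + r) * B') / of_nat (2 * j + r + 2)"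
    unfolding c_odd_Suc[OF assms] by (simp del: of_nat_Suc of_nat_add add: ac_simps)
  also have "\<dots> = of_nat (2 * j + r + 3) * (c r (Suc j) * B)"
    unfolding B' by (simp del: of_nat_Suc of_nat_add)
  also have "\<dots> = of_nat (2 * j + r + 3) * (2 ^ Suc j * ell_value r j)"
    unfolding Suc.IH B_def ..
  \<comment> \<open>The new power of two comes from
    \<open>2 * j + r + 3 = 2 * (j + 2 + m)\<close>.\<close>
  also have "\<dots> = 2 ^ Suc (Suc j) * (of_nat (j + 2 + m) * ell_value r j)"
    by (simp add: r algebra_simps)
  also have "\<dots> = of_nat (j + 2) * (2 ^ Suc (Suc j) * ell_value r (Suc j))"
    unfolding r ell_value_Suc[symmetric] by (simp only: ac_simps)
  finally have "2 ^ Suc (Suc j) * ell_value r (Suc j) = c r (Suc (Suc j)) * B''"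
    by (simp del: of_nat_Suc of_nat_add power_Suc)
  moreover have "2 * Suc j + r + 1 = 2 * j + r + 3"
    by simp
  ultimately show ?case
    unfolding B''_def by metis
qed

text \<open>This is the claimed formula for \<open>R\<close> at \<open>k = Suc j\<close>, solved for
  the value of \<open>P n\<close>; the terms \<open>2 ^ (n + k - 1)\<close> cancel.\<close>

definition P_value :: "nat \<Rightarrow> nat \<Rightarrow> rat" where
  "P_value n j = c n (Suc j) / 2 ^ j * S n j"

text \<open>The factor \<open>Suc j\<close> merges the two neighbouring coefficients in
  \<open>S_Suc_right\<close> into one, since their quotient is
  \<open>(Suc j + n) / Suc j\<close>.\<close>

lemma S_Suc_right':
  "of_nat (Suc j) * S n (Suc j) =
    4 * of_nat (Suc j) * S n j - of_nat n * of_nat ((2 * j + n + 1) choose j)"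
proof -
  have "Suc j * ((2 * j + n + 1) choose Suc j) = (Suc j + n) * ((2 * j + n + 1) choose j)"
    unfolding Suc_times_binomial_Suc by simp
  then have "of_nat (Suc j) * (of_nat ((2 * j + n + 1) choose Suc j) :: rat) =
      of_nat (Suc j + n) * of_nat ((2 * j + n + 1) choose j)"
    by (metis of_nat_mult)
  then show ?thesis
    by (simp add: S_Suc_right algebra_simps)
qed

lemma P_value_Suc_odd:
  assumes "odd n"
  shows "4 * (2 * of_nat (Suc j) + of_nat n) * P_value (Suc n) j =
    2 * (of_nat (Suc j) + of_nat n) * P_value n j
      + (2 * of_nat (Suc j) + of_nat n) * P_value n (Suc j)
      + (4 * of_nat (Suc j) + of_nat n) * ell_value n j"
proof -
  define k N C T B E :: rat where "k = of_nat (Suc j)" and "N = of_nat n" and "C = c n (Suc j)"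
    and "T = 2 ^ j" and "B = of_nat ((2 * j + n + 1) choose j)" and "E = ell_value n j"
  have pos: "k > 0" "N \<ge> 0" "T > 0"
    by (simp_all add: k_def N_def T_def)
  then have nz: "k \<noteq> 0" "T \<noteq> 0" "2 * k + N \<noteq> 0"
    by auto
  have c1: "c (Suc n) (Suc j) = C * (N + k) / (2 * (2 * k + N))"
    using c_Suc_odd[OF assms, of j] by (simp add: C_def N_def k_def algebra_simps)
  have c2: "c n (Suc (Suc j)) = C * (N + k) / (2 * k + N)"
    using c_odd_Suc[OF assms, of j] by (simp add: C_def N_def k_def algebra_simps)
  have S1: "S (Suc n) j = 2 * S n j + B"
    by (simp add: S_Suc B_def)
  have S2: "S n (Suc j) = (4 * k * S n j - N * B) / k"
    using S_Suc_right'[of j n] nz unfolding k_def N_def B_def by (simp add: field_simps)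
  have "k * (2 * T * E) = C * (k * of_nat ((2 * j + n + 1) choose Suc j))"
    using ell_value_odd[OF assms, of j] by (simp add: T_def E_def C_def)
  also have "k * of_nat ((2 * j + n + 1) choose Suc j) = (k + N) * B"
    \<comment> \<open>Equating the two expressions for \<open>S n (Suc j)\<close> yields the
      quotient of neighbouring coefficients.\<close>
    using S_Suc_right'[of j n, unfolded S_Suc_right] by (simp add: k_def N_def B_def algebra_simps)
  finally have E: "E = C * (k + N) * B / (2 * T * k)"
    using nz by (simp add: field_simps)
  \<comment> \<open>Divided by \<open>C / T\<close>, both sides equal
    \<open>(k + N) * (4 * S n j + 2 * B)\<close>.\<close>
  have "4 * (2 * k + N) * (C * (N + k) / (2 * (2 * k + N)) / T * (2 * S n j + B)) =
      2 * (k + N) * (C / T * S n j)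
      + (2 * k + N) * (C * (N + k) / (2 * k + N) / (2 * T) * ((4 * k * S n j - N * B) / k))
      + (4 * k + N) * (C * (k + N) * B / (2 * T * k))"
    using nz by (simp add: divide_simps) algebra
  then show ?thesis
    unfolding P_value_def c1 c2 S1 S2 k_def[symmetric] N_def[symmetric] C_def[symmetric]
      T_def[symmetric] E_def[symmetric] E power_Suc .
qed

lemma P_value_Suc_even:
  assumes "even n" "n \<ge> 2"
  shows "4 * P_value (Suc n) j =
    4 * (of_nat (Suc j) + of_nat n) * P_value n j
      + 2 * (2 * of_nat (Suc j) + of_nat n + 1) * P_value n (Suc j)
      + (4 * of_nat (Suc j) + of_nat n) * ell_value (n - 1) j"
proof -
  from assms obtain r where n: "n = Suc r" and r: "odd r"
    by (cases n) auto
  define k N C T B E :: rat where "k = of_nat (Suc j)" and "N = of_nat n" and "C = c n (Suc j)"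
    and "T = 2 ^ j" and "B = of_nat ((2 * j + n + 1) choose j)" and "E = ell_value r j"
  have pos: "k > 0" "N \<ge> 0" "T > 0" "2 * k + N > 1"
    by (simp_all add: k_def N_def T_def n)
  then have nz: "k \<noteq> 0" "T \<noteq> 0" "2 * k + N + 1 \<noteq> 0" "2 * k + N - 1 \<noteq> 0"
    by auto
  have c1: "c (Suc n) (Suc j) = C * (N + k)"
    using c_Suc_even[OF assms, of j] by (simp add: C_def N_def k_def algebra_simps)
  have c2: "c n (Suc (Suc j)) = C * (N + k) / (2 * k + N + 1)"
    using c_even_Suc[OF assms(1), of j] by (simp add: C_def N_def k_def algebra_simps)
  have S1: "S (Suc n) j = 2 * S n j + B"
    by (simp add: S_Suc B_def)
  have S2: "S n (Suc j) = (4 * k * S n j - N * B) / k"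
    using S_Suc_right'[of j n] nz unfolding k_def N_def B_def by (simp add: field_simps)
  have "(n + j) * ((2 * j + n + 1) choose Suc j) = (2 * j + n + 1) * ((2 * j + r + 1) choose Suc j)"
    using binomial_absorb_comp[of "2 * j + n + 1" "Suc j"] by (simp add: n ac_simps)
  then have b: "of_nat (n + j) * of_nat ((2 * j + n + 1) choose Suc j) =
      of_nat (2 * j + n + 1) * (of_nat ((2 * j + r + 1) choose Suc j) :: rat)"
    by (metis of_nat_mult)
  have cr: "2 * (2 * k + N - 1) * C = c r (Suc j) * (N + k - 1)"
    using c_Suc_odd[OF r, of j] nz by (simp add: C_def N_def k_def n field_simps)
  \<comment> \<open>\<open>ell\<close> has the odd index \<open>r = n - 1\<close>. Passing from
    \<open>r\<close> to \<open>n\<close> changes \<open>c\<close> and the binomial coefficient by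
    quotients whose product is a constant: the factors \<open>2 * k + N - 1\<close> and
    \<open>N + k - 1\<close> cancel, leaving twice the value of the odd case.\<close>
  have "k * (T * E) = C * (k * of_nat ((2 * j + n + 1) choose Suc j))"
  proof -
    define b b' :: rat where "b = of_nat ((2 * j + n + 1) choose Suc j)"
      and "b' = of_nat ((2 * j + r + 1) choose Suc j)"
    have b: "(N + k - 1) * b = (2 * k + N - 1) * b'"
      using b unfolding b_def[symmetric] b'_def[symmetric] by (simp add: N_def k_def algebra_simps)
    have "2 * (T * E) = c r (Suc j) * b'"
      using ell_value_odd[OF r, of j] by (simp add: T_def E_def b'_def)
    then have "2 * ((N + k - 1) * (T * E)) = c r (Suc j) * (N + k - 1) * b'"
      by simp
    also have "\<dots> = 2 * C * ((N + k - 1) * b)"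
      unfolding cr[symmetric] b by (simp only: ac_simps)
    finally have "(N + k - 1) * (T * E) = (N + k - 1) * (C * b)"
      by simp
    moreover have "N + k - 1 = of_nat (Suc (r + j))"
      by (simp add: N_def k_def n)
    then have "N + k - 1 \<noteq> 0"
      by (simp only: of_nat_eq_0_iff)
    ultimately show ?thesis
      by (simp add: b_def)
  qed
  also have "k * of_nat ((2 * j + n + 1) choose Suc j) = (k + N) * B"
    using S_Suc_right'[of j n, unfolded S_Suc_right] by (simp add: k_def N_def B_def algebra_simps)
  finally have E: "E = C * (k + N) * B / (T * k)"
    using nz by (simp add: field_simps)
  \<comment> \<open>Divided by \<open>C / T\<close>, both sides equal
    \<open>(k + N) * (8 * S n j + 4 * B)\<close>.\<close>
  have "4 * (C * (N + k) / T * (2 * S n j + B)) =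
      4 * (k + N) * (C / T * S n j)
      + 2 * (2 * k + N + 1) * (C * (N + k) / (2 * k + N + 1) / (2 * T) * ((4 * k * S n j - N * B) / k))
      + (4 * k + N) * (C * (k + N) * B / (T * k))"
  proof -
    have cancel: "2 * W * (y / W / (2 * T) * z) = y / T * z" if "W \<noteq> 0" for W y z
      using that by simp
    show ?thesis
      unfolding cancel[OF nz(3)] using nz(1,2) by (simp add: field_simps)
  qed
  moreover have "n - 1 = r"
    by (simp add: n)
  ultimately show ?thesis
    unfolding P_value_def c1 c2 S1 S2 k_def[symmetric] N_def[symmetric] C_def[symmetric]
      T_def[symmetric] E power_Suc by (simp only: E_def[symmetric] E)
qed

text \<open>The point stays arbitrary in the induction because \<open>shift\<close> asks for the
  value of \<open>P n\<close> at the next integer.\<close>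

lemma has_value_P:
  assumes "n \<ge> 1"
  shows "has_value (P n) (of_nat (Suc j)) (P_value n j)"
  using assms
proof (induction n arbitrary: j rule: dec_induct)
  case base
  \<comment> \<open>For \<open>r = 1\<close> the product \<open>ell\<close> is empty, so
    \<open>ell_value_odd\<close> evaluates \<open>c 1 (Suc j)\<close> times a central binomial
    coefficient.\<close>
  have "2 ^ Suc j * ell_value 1 j = c 1 (Suc j) * of_nat ((2 * j + 2) choose Suc j)"
    using ell_value_odd[of 1 j] by simp
  moreover have "(2 * j + 2) choose Suc j = 2 * ((2 * j + 1) choose j)"
    using binomial_symmetric[of j "2 * j + 1"] by simp
  ultimately have "2 * 2 ^ j = c 1 (Suc j) * (2 * of_nat ((2 * j + 1) choose j))"
    by (simp only: of_nat_mult) (simp add: ell_value_def)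
  then have "P_value 1 j = 1"
    using c_nonzero[of 1 "Suc j"] by (simp add: P_value_def S_def del: binomial_Suc_Suc)
  then show ?case
    using has_value_1 by simp
next
  case (step n)
  have sh: "has_value (shift (P n)) (of_nat (Suc j)) (P_value n (Suc j))"
    using step.IH[of "Suc j"] by (intro has_value_shift) (simp add: ac_simps)
  consider "n = 1" | "n \<ge> 2" "odd n" | "n \<ge> 2" "even n"
    using step.hyps by linarith
  then show ?case
  proof cases
    case 1
    \<comment> \<open>\<open>P 2\<close> is an initial value, not an instance of the recurrence. But
      \<open>P_value\<close> satisfies the odd recurrence at \<open>n = 1\<close> too, and with
      \<open>P_value 1 i = 1\<close> this forces \<open>P_value 2 j = 1\<close>.\<close>
    have "P_value 1 i = 1" for i
      using eval_eqI[OF step.IH[of i]] eval_eqI[OF has_value_1] by (simp add: 1)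
    then have "of_nat (12 + 8 * j) * P_value 2 j = of_nat (12 + 8 * j)"
      using P_value_Suc_odd[of 1 j] by (simp add: ell_value_def numeral_2_eq_2 algebra_simps)
    then have "P_value 2 j = 1"
      by (metis add_is_0 mult_cancel_left1 of_nat_eq_0_iff zero_neq_numeral)
    then show ?thesis
      using has_value_1 by (simp add: 1 numeral_2_eq_2)
  next
    case 2
    \<comment> \<open>The divisor in the recurrence is nonzero at positive integers, so the quotient
      is regular there.\<close>
    have nz: "4 * (2 * of_nat (Suc j) + of_nat n) \<noteq> (0 :: rat)"
      by (simp add: add_eq_0_iff)
    have "P_value (Suc n) j = (2 * (of_nat (Suc j) + of_nat n) * P_value n j
      + (2 * of_nat (Suc j) + of_nat n) * P_value n (Suc j)
      + (4 * of_nat (Suc j) + of_nat n) * ell_value n j) / (4 * (2 * of_nat (Suc j) + of_nat n))"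
      unfolding P_value_Suc_odd[OF 2(2), symmetric] using nz by simp
    moreover have "has_value (P (Suc n)) (of_nat (Suc j)) \<dots>"
      using 2 nz sh by (simp del: of_nat_Suc) (intro has_value_intros has_value_ell step.IH, auto)
    ultimately show ?thesis
      by (simp only:)
  next
    case 3
    have "P_value (Suc n) j = (4 * (of_nat (Suc j) + of_nat n) * P_value n j
      + 2 * (2 * of_nat (Suc j) + of_nat n + 1) * P_value n (Suc j)
      + (4 * of_nat (Suc j) + of_nat n) * ell_value (n - 1) j) / 4"
      unfolding P_value_Suc_even[OF 3(2,1), symmetric] by simp
    moreover have "has_value (P (Suc n)) (of_nat (Suc j)) \<dots>"
      using 3 sh by (simp del: of_nat_Suc) (intro has_value_intros has_value_ell step.IH, auto)
    ultimately show ?thesis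
      by (simp only:)
  qed
qed

theorem theorem4:
  fixes k n :: nat
  assumes "k \<ge> 1" and "n \<ge> 1"
  shows "R k n = 2 ^ n * fact (k - 1) * 4 ^ (k - 1)
    - (\<Sum>i = 1..n. 2 ^ (n - i) * (fact (2 * k + i - 2) / fact (k + i - 1)))"
proof -
  from assms(1) obtain j where k: "k = Suc j"
    by (metis Suc_pred' less_eq_Suc_le One_nat_def)
  have "eval (P n) (of_nat k) / c n k = S n j / 2 ^ j"
    using eval_eqI[OF has_value_P[OF assms(2), of j]] c_nonzero[OF assms(2), of k]
    by (simp add: k P_value_def)
  \<comment> \<open>The prefactor \<open>2 ^ (k - 1)\<close> cancels the denominator
    \<open>2 ^ j\<close> under \<open>S n j\<close>.\<close>
  then have "R k n = 2 ^ n * fact j * (2 ^ j * 2 ^ j) - fact j * S n j"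
    by (simp add: R_def k field_simps power_add)
  moreover have "(2 :: rat) ^ j * 2 ^ j = 4 ^ j"
    by (simp flip: power_mult_distrib)
  moreover have "fact j * S n j = (\<Sum>i = 1..n. 2 ^ (n - i) * (fact (2 * j + i) / fact (j + i)))"
    unfolding S_def sum_distrib_left
    by (intro sum.cong refl) (simp add: binomial_fact mult_2 add.assoc)
  ultimately show ?thesis
    by (simp add: k)
qed

end
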